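(* Let $r$ be a positive integer and $n = r(r+1)/2$. Then $f_3(n) \le r$; that is, there exist three linear orders $\pi_1,\pi_2,\pi_3$ on an $n$-element set $V$ such that every acyclic (equivalently, transitive) induced sub-tournament of the $3$-majority tournament of $\{\pi_1,\pi_2,\pi_3\}$ has at most $r$ vertices.
   Context: Let $\Pi=\{\pi_1,\dots,\pi_k\}$ be a set of $k$ linear orders on a finite ground set $V$. The $k$-majority digraph of $\Pi$ has vertex set $V$ and, for distinct $u,v\in V$, an edge from $u$ to $v$ if and only if a strict majority of the $k$ linear orders rank $u$ before $v$. When $k$ is odd this digraph is a tournament, called a $k$-majority tournament. A set of vertices of a digraph $G$ is acyclic if the subgraph it induces contains no directed cycle; $a(G)$ denotes the maximum size of an acyclic set in $G$. For odd $k$ and $n\ge 1$, $f_k(n)=\min\{a(T): T \text{ is an } n\text{-vertex } k\text{-majority tournament}\}$, i.e. the minimum over all $n$-vertex $k$-majority tournaments of the maximum order of an induced transitive sub-tournament. *)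

theory Defs
  imports "Graph_Theory.Graph_Theory"
begin

text \<open>
  The linear orders are given by a list, so that \<open>k\<close> is its length and repetitions are allowed
  (a one-element vertex set has only one linear order). \<open>(u, v) \<in> \<pi>\<close> reads
  ``\<open>\<pi>\<close> ranks \<open>u\<close> before \<open>v\<close>''; the orders are reflexive, but only distinct \<open>u\<close>, \<open>v\<close> are compared.
\<close>

definition majority_digraph :: "'a set \<Rightarrow> 'a rel list \<Rightarrow> 'a pair_pre_digraph" where
  "majority_digraph V L =
     \<lparr> pverts = V,
       parcs = {(u, v). u \<in> V \<and> v \<in> V \<and> u \<noteq> v \<and>
                        2 * length (filter (\<lambda>\<pi>. (u, v) \<in> \<pi>) L) > length L} \<rparr>"

definition majority_tournament :: "nat \<Rightarrow> 'a pair_pre_digraph \<Rightarrow> bool" where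
  "majority_tournament k T \<longleftrightarrow> odd k \<and>
     (\<exists>V L. finite V \<and> length L = k \<and> (\<forall>\<pi>\<in>set L. linear_order_on V \<pi>) \<and>
            T = majority_digraph V L)"

definition acyclic_set :: "('a, 'b) pre_digraph \<Rightarrow> 'a set \<Rightarrow> bool" where
  "acyclic_set G S \<longleftrightarrow> S \<subseteq> verts G \<and> \<not> (\<exists>p. pre_digraph.cycle (G \<restriction> S) p)"

definition transitive_set :: "('a, 'b) pre_digraph \<Rightarrow> 'a set \<Rightarrow> bool" where
  "transitive_set G S \<longleftrightarrow> S \<subseteq> verts G \<and> trans (arcs_ends (G \<restriction> S))"

definition max_acyclic :: "('a, 'b) pre_digraph \<Rightarrow> nat" where
  "max_acyclic G = Max {card S | S. acyclic_set G S}"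

text \<open>
  The number \<open>f\<^sub>k(n)\<close>. Every finite tournament is isomorphic to one whose vertices are natural
  numbers, so it suffices to let \<open>T\<close> range over these.
\<close>

definition f_majority :: "nat \<Rightarrow> nat \<Rightarrow> nat" where
  "f_majority k n =
     Min {max_acyclic (with_proj T) | T :: nat pair_pre_digraph.
            majority_tournament k T \<and> card (pverts T) = n}"

text \<open>
  The extrema above are taken over finite nonempty sets, and majority tournaments are tournaments.
\<close>

lemma max_acyclic_set_finite:
  assumes "finite (verts G)"
  shows "finite {card S | S. acyclic_set G S}"
proof -
  have "{card S | S. acyclic_set G S} \<subseteq> card ` Pow (verts G)"
    by (auto simp: acyclic_set_def)
  then show ?thesis using assms by (meson finite_Pow_iff finite_imageI finite_subset)
qed

lemma acyclic_set_empty: "acyclic_set G {}"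
  by (auto simp: acyclic_set_def pre_digraph.cycle_def pre_digraph.awalk_def)

lemma f_majority_set_finite:
  "finite {max_acyclic (with_proj T) | T :: nat pair_pre_digraph.
             majority_tournament k T \<and> card (pverts T) = n}"
proof -
  have "max_acyclic (with_proj T) \<le> n"
    if "majority_tournament k T" "card (pverts T) = n" for T :: "nat pair_pre_digraph"
  proof -
    have fin: "finite (verts (with_proj T))"
      using that(1) by (auto simp: majority_tournament_def majority_digraph_def)
    show ?thesis unfolding max_acyclic_def
    proof (rule Max.boundedI[OF max_acyclic_set_finite[OF fin]])
      show "{card S |S. acyclic_set (with_proj T) S} \<noteq> {}"
        using acyclic_set_empty by blast
      show "a \<le> n" if "a \<in> {card S |S. acyclic_set (with_proj T) S}" for a
        using that \<open>card (pverts T) = n\<close> fin by (auto simp: acyclic_set_def intro: card_mono)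
    qed
  qed
  then have "{max_acyclic (with_proj T) | T :: nat pair_pre_digraph.
             majority_tournament k T \<and> card (pverts T) = n} \<subseteq> {..n}"
    by auto
  then show ?thesis using finite_subset by blast
qed

lemma f_majority_set_nonempty:
  assumes "odd k"
  shows "{max_acyclic (with_proj T) | T :: nat pair_pre_digraph.
            majority_tournament k T \<and> card (pverts T) = n} \<noteq> {}"
proof -
  define r where "r = {(i, j). i < n \<and> j < n \<and> i \<le> (j::nat)}"
  have "linear_order_on {..<n} r"
    by (auto simp: r_def order_on_defs refl_on_def trans_def antisym_def total_on_def)
  then have "majority_tournament k (majority_digraph {..<n} (replicate k r))"
    using assms by (auto simp: majority_tournament_def intro!: exI[of _ "{..<n}"] exI[of _ "replicate k r"])
  moreover have "card (pverts (majority_digraph {..<n} (replicate k r))) = n"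
    by (simp add: majority_digraph_def)
  ultimately show ?thesis by blast
qed

lemma majority_tournament_is_tournament:
  assumes "majority_tournament k T"
  shows "pair_digraph T"
    and "\<lbrakk>u \<in> pverts T; v \<in> pverts T; u \<noteq> v\<rbrakk> \<Longrightarrow> (u, v) \<in> parcs T \<longleftrightarrow> (v, u) \<notin> parcs T"
proof -
  from assms obtain V L where V: "odd (length L)" "finite V"
      "\<forall>\<pi>\<in>set L. linear_order_on V \<pi>" "T = majority_digraph V L"
    by (auto simp: majority_tournament_def)
  have "parcs T \<subseteq> V \<times> V" using V by (auto simp: majority_digraph_def)
  then have "finite (parcs T)" using V by (meson finite_SigmaI finite_subset)
  then show "pair_digraph T"
    using V by unfold_locales (auto simp: majority_digraph_def)
  assume uv: "u \<in> pverts T" "v \<in> pverts T" "u \<noteq> v"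
  have "filter (\<lambda>\<pi>. (v, u) \<in> \<pi>) L = filter (\<lambda>\<pi>. \<not> (u, v) \<in> \<pi>) L"
    using V uv
  proof (intro filter_cong refl)
    fix \<pi> assume "\<pi> \<in> set L"
    then have "total_on V \<pi>" "antisym \<pi>" using V by (auto simp: order_on_defs)
    then show "(v, u) \<in> \<pi> \<longleftrightarrow> \<not> (u, v) \<in> \<pi>"
      using V uv unfolding total_on_def antisym_def majority_digraph_def by auto
  qed
  then have "length (filter (\<lambda>\<pi>. (v, u) \<in> \<pi>) L) + length (filter (\<lambda>\<pi>. (u, v) \<in> \<pi>) L) = length L"
    using sum_length_filter_compl[of "\<lambda>\<pi>. (u, v) \<in> \<pi>" L] by simp
  with V(1) have "2 * length (filter (\<lambda>\<pi>. (u, v) \<in> \<pi>) L) > length L \<longleftrightarrow>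
      \<not> 2 * length (filter (\<lambda>\<pi>. (v, u) \<in> \<pi>) L) > length L"
    by presburger
  then show "(u, v) \<in> parcs T \<longleftrightarrow> (v, u) \<notin> parcs T"
    using V(4) uv by (simp add: majority_digraph_def)
qed

end

theory Submission
  imports Defs "HOL-Library.Nat_Bijection"
begin

text \<open>
  The vertices are the lattice points \<open>(x, y, z)\<close> with \<open>x + y + z = r - 1\<close>, ranked by \<open>x\<close>,
  \<open>y\<close> and \<open>z\<close>, where ties are broken cyclically: by \<open>y\<close>, \<open>z\<close> and \<open>x\<close>, respectively.
  Seen from a point \<open>s\<close>, the out-neighbours of \<open>s\<close> fill three of the six sectors bounded by the
  lattice lines through \<open>s\<close>. An acyclic set \<open>S\<close> has a source \<open>s\<close>, so its other points lie in
  these three sectors. Let \<open>S\<close> lie in a triangle of side \<open>m\<close> (counted in points), and \<open>s\<close> at distances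
  \<open>a\<close>, \<open>b\<close>, \<open>c\<close> from the three sides, so \<open>m = 1 + a + b + c\<close>. The sectors cut the triangle in
  triangles of sides \<open>a\<close>, \<open>b\<close> and \<open>c\<close>, and by induction \<open>card S \<le> 1 + a + b + c = m\<close>.
\<close>

text \<open>On a plane of constant \<open>x + y + z\<close>, each disjunct is a sector that keeps
  only one of its two boundary rays; the strict inequalities mirror the cyclic tie-breaking.\<close>

definition out_sectors :: "('a \<Rightarrow> int) \<Rightarrow> ('a \<Rightarrow> int) \<Rightarrow> ('a \<Rightarrow> int) \<Rightarrow> 'a \<Rightarrow> 'a set" where
  "out_sectors x y z s = {v. x s \<le> x v \<and> y s < y v \<or> y s \<le> y v \<and> z s < z v \<or> z s \<le> z v \<and> x s < x v}"

text \<open>The triangle is given by the lower bounds \<alpha>, \<beta>, \<gamma>, which move in the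
  induction. Asking for a source in every nonempty subset makes that hypothesis pass to the smaller
  sets. The last hypothesis admits side 0, where \<open>S\<close> must be empty.\<close>

lemma card_le_triangle_side:
  fixes x y z :: "'a \<Rightarrow> int"
  assumes "finite S"
    and "\<And>v. v \<in> S \<Longrightarrow> x v + y v + z v = N"
    and "\<And>v. v \<in> S \<Longrightarrow> \<alpha> \<le> x v \<and> \<beta> \<le> y v \<and> \<gamma> \<le> z v"
    and "\<And>X. X \<subseteq> S \<Longrightarrow> X \<noteq> {} \<Longrightarrow> \<exists>s\<in>X. X - {s} \<subseteq> out_sectors x y z s"
    and "\<alpha> + \<beta> + \<gamma> \<le> N + 1"
  shows "int (card S) \<le> N + 1 - (\<alpha> + \<beta> + \<gamma>)"
  using assms
proof (induction "card S" arbitrary: S \<alpha> \<beta> \<gamma> rule: less_induct)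
  case less
  show ?case
  proof (cases "S = {}")
    case True
    then show ?thesis using less.prems(5) by simp
  next
    case False
    with less.prems(4) obtain s where s: "s \<in> S" "S - {s} \<subseteq> out_sectors x y z s"
      by blast
    have s_bounds: "x s + y s + z s = N" "\<alpha> \<le> x s" "\<beta> \<le> y s" "\<gamma> \<le> z s"
      using less.prems(2,3) s(1) by auto
    define A where "A = {v \<in> S - {s}. x s \<le> x v \<and> y s < y v}"
    define B where "B = {v \<in> S - {s}. y s \<le> y v \<and> z s < z v}"
    define C where "C = {v \<in> S - {s}. z s \<le> z v \<and> x s < x v}"
    have smaller: "card X < card S" if "X \<subseteq> S - {s}" for X
      using that s(1) less.prems(1) by (intro psubset_card_mono) auto
    \<comment> \<open>The sector raises two of the lower bounds and keeps the third, so the new side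
      is \<open>z s - \<gamma>\<close>, which is nonnegative. The other two sides are
      \<open>x s - \<alpha>\<close> and \<open>y s - \<beta>\<close>.\<close>
    have "int (card A) \<le> N + 1 - (x s + (y s + 1) + \<gamma>)"
      using s_bounds less.prems unfolding A_def by (intro less.hyps smaller) auto
    moreover have "int (card B) \<le> N + 1 - (\<alpha> + y s + (z s + 1))"
      using s_bounds less.prems unfolding B_def by (intro less.hyps smaller) auto
    moreover have "int (card C) \<le> N + 1 - ((x s + 1) + \<beta> + z s)"
      using s_bounds less.prems unfolding C_def by (intro less.hyps smaller) auto
    moreover have "card S \<le> 1 + (card A + card B + card C)"
    proof -
      have "S = insert s (A \<union> B \<union> C)"
        using s by (auto simp: A_def B_def C_def out_sectors_def)
      then have "card S \<le> Suc (card (A \<union> B \<union> C))"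
        by (metis card_insert_le_m1 card_insert_if diff_Suc_1 finite.emptyI less.prems(1)
            finite_insert le_SucI order_refl)
      also have "card (A \<union> B \<union> C) \<le> card A + card B + card C"
        by (meson add_le_mono1 card_Un_le le_trans)
      finally show ?thesis by simp
    qed
    ultimately show ?thesis using s_bounds(1) by linarith
  qed
qed

text \<open>A nonempty closed walk contains a cycle. This reduces acyclic sets to the arc relation,
  where facts on transitive closure and well-foundedness apply.\<close>

lemma (in wf_digraph) acyclic_set_iff:
  assumes "S \<subseteq> verts G"
  shows "acyclic_set G S \<longleftrightarrow> acyclic (arcs_ends (G \<restriction> S))"
proof -
  interpret H: wf_digraph "G \<restriction> S"
    by (rule wellformed_induce_subgraph)
  show ?thesis
  proof
    assume *: "acyclic_set G S"
    show "acyclic (arcs_ends (G \<restriction> S))"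
      unfolding acyclic_def
    proof (intro allI notI)
      fix u assume "(u, u) \<in> (arcs_ends (G \<restriction> S))\<^sup>+"
      then obtain p where "H.awalk u p u" "p \<noteq> []"
        using H.reachable1_awalk by blast
      then have "H.closed_w p"
        by (auto simp: H.closed_w_def)
      then show False
        using H.closed_w_imp_cycle * by (auto simp: acyclic_set_def)
    qed
  next
    assume *: "acyclic (arcs_ends (G \<restriction> S))"
    have False if "H.cycle p" for p
      using that * H.reachable1_awalk unfolding H.cycle_def acyclic_def by blast
    then show "acyclic_set G S"
      using assms by (auto simp: acyclic_set_def)
  qed
qed

text \<open>If \<open>u\<close> beats \<open>v\<close> and \<open>v\<close> beats \<open>w\<close>,
  an arc from \<open>w\<close> to \<open>u\<close> would close a cycle, so the tournament has the
  arc from \<open>u\<close> to \<open>w\<close>. Conversely, a transitive relation is its own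
  transitive closure, and there are no loops.\<close>

lemma acyclic_set_iff_transitive_set:
  assumes T: "majority_tournament k T"
  shows "acyclic_set (with_proj T) S \<longleftrightarrow> transitive_set (with_proj T) S"
proof (cases "S \<subseteq> pverts T")
  case True
  interpret pair_digraph T
    by (rule majority_tournament_is_tournament[OF T])
  let ?E = "arcs_ends (with_proj T \<restriction> S)"
  have E: "(u, v) \<in> ?E \<longleftrightarrow> (u, v) \<in> parcs T \<and> u \<in> S \<and> v \<in> S" for u v
    by (auto simp: arcs_ends_conv)
  have irr: "(u, u) \<notin> ?E" for u
    using no_loops[of "(u, u)"] E by auto
  have "trans ?E" if ac: "acyclic ?E"
  proof (rule transI)
    fix u v w assume uvw: "(u, v) \<in> ?E" "(v, w) \<in> ?E"
    then have uw: "(u, w) \<in> ?E\<^sup>+" by auto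
    then have "u \<noteq> w" using ac by (auto simp: acyclic_def)
    moreover have "(w, u) \<notin> ?E"
      using uw ac by (auto simp: acyclic_def dest: trancl_into_trancl)
    ultimately show "(u, w) \<in> ?E"
      using uvw True majority_tournament_is_tournament(2)[OF T, of u w] unfolding E by blast
  qed
  moreover have "acyclic ?E" if "trans ?E"
    using that irr by (simp add: acyclic_irrefl trancl_id irrefl_def)
  ultimately show ?thesis
    using True acyclic_set_iff[of S] by (auto simp: transitive_set_def)
qed (auto simp: acyclic_set_def transitive_set_def)

text \<open>A finite acyclic relation is well-founded; a minimal element of \<open>X\<close> is
  beaten by nobody in \<open>X\<close>, hence beats all the others.\<close>

lemma acyclic_set_source:
  assumes T: "majority_tournament k T" and "acyclic_set (with_proj T) S"
    and "X \<subseteq> S" "X \<noteq> {}"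
  obtains s where "s \<in> X" "\<And>v. v \<in> X - {s} \<Longrightarrow> (s, v) \<in> parcs T"
proof -
  interpret pair_digraph T
    by (rule majority_tournament_is_tournament[OF T])
  let ?E = "arcs_ends (with_proj T \<restriction> S)"
  have sub: "S \<subseteq> pverts T"
    using assms(2) by (simp add: acyclic_set_def)
  have "?E \<subseteq> parcs T"
    by (auto simp: arcs_ends_conv)
  then have "finite ?E"
    by (metis finite_subset finite_arcs with_proj_simps(2))
  moreover have "acyclic ?E"
    using assms(2) acyclic_set_iff[of S] sub by simp
  ultimately have "wf ?E"
    by (rule finite_acyclic_wf)
  then obtain s where s: "s \<in> X" "\<And>v. (v, s) \<in> ?E \<Longrightarrow> v \<notin> X"
    using \<open>X \<noteq> {}\<close> by (metis wfE_min ex_in_conv)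
  have "(s, v) \<in> parcs T" if "v \<in> X - {s}" for v
  proof -
    have "(v, s) \<notin> parcs T"
      using that s \<open>X \<subseteq> S\<close> by (force simp: arcs_ends_conv)
    then show ?thesis
      using that s(1) \<open>X \<subseteq> S\<close> sub majority_tournament_is_tournament(2)[OF T, of s v] by blast
  qed
  with s(1) show thesis by (rule that)
qed

definition lex_order :: "'a set \<Rightarrow> ('a \<Rightarrow> int) \<Rightarrow> ('a \<Rightarrow> int) \<Rightarrow> 'a rel" where
  "lex_order V p q = {(u, v). u \<in> V \<and> v \<in> V \<and> (p u < p v \<or> p u = p v \<and> q u \<le> q v)}"

lemma linear_order_on_lex_order:
  assumes "\<And>u v. \<lbrakk>u \<in> V; v \<in> V; p u = p v; q u = q v\<rbrakk> \<Longrightarrow> u = v"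
  shows "linear_order_on V (lex_order V p q)"
proof -
  have "refl_on V (lex_order V p q)" "lex_order V p q \<subseteq> V \<times> V"
    by (auto simp: lex_order_def refl_on_def)
  moreover have "trans (lex_order V p q)"
    unfolding trans_def lex_order_def by auto
  moreover have "antisym (lex_order V p q)"
    using assms unfolding antisym_def lex_order_def by force
  moreover have "total_on V (lex_order V p q)"
    unfolding total_on_def lex_order_def by auto
  ultimately show ?thesis
    by (simp add: order_on_defs)
qed

text \<open>If all coordinates differ, the majority says that two of them increase. If just one
  agrees, its order defers to the next coordinate, which thus decides two of the three orders and
  must increase. Two agreements would force \<open>u = v\<close>.\<close>

lemma majority_lex_order_out_sectors:
  fixes x y z :: "'a \<Rightarrow> int"
  assumes inj: "\<And>u v. \<lbrakk>u \<in> V; v \<in> V; x u = x v; y u = y v\<rbrakk> \<Longrightarrow> u = v"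
    and sum: "\<And>v. v \<in> V \<Longrightarrow> x v + y v + z v = N"
    and arc: "(u, v) \<in> parcs (majority_digraph V [lex_order V x y, lex_order V y z, lex_order V z x])"
  shows "v \<in> out_sectors x y z u"
proof -
  have uv: "u \<in> V" "v \<in> V" "u \<noteq> v"
    using arc by (auto simp: majority_digraph_def)
  then have "x u \<noteq> x v \<or> y u \<noteq> y v"
    using inj by blast
  then show ?thesis
    using arc sum[OF uv(1)] sum[OF uv(2)]
    by (auto simp: majority_digraph_def lex_order_def out_sectors_def split: if_splits)
qed

theorem theorem2p2:
  fixes r n :: nat
  assumes "r > 0" and "n = r * (r + 1) div 2"
  shows "f_majority 3 n \<le> r \<and>
    (\<exists>(V :: nat set) \<pi>\<^sub>1 \<pi>\<^sub>2 \<pi>\<^sub>3.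
       finite V \<and> card V = n \<and>
       linear_order_on V \<pi>\<^sub>1 \<and> linear_order_on V \<pi>\<^sub>2 \<and> linear_order_on V \<pi>\<^sub>3 \<and>
       (let T = with_proj (majority_digraph V [\<pi>\<^sub>1, \<pi>\<^sub>2, \<pi>\<^sub>3]) in
          (\<forall>S \<subseteq> V. acyclic_set T S \<longleftrightarrow> transitive_set T S) \<and>
          (\<forall>S. acyclic_set T S \<longrightarrow> card S \<le> r)))"
proof -
  \<comment> \<open>These are the pairs \<open>(x, y)\<close> of the lattice triangle of side
    \<open>r\<close>. They are encoded as naturals because \<open>f_majority\<close> ranges over
    digraphs on \<open>nat\<close>.\<close>
  define P :: "(nat \<times> nat) set" where "P = (SIGMA i:{..<r}. {..<r - i})"
  define V where "V = prod_encode ` P"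
  define x where "x = (\<lambda>v. int (fst (prod_decode v)))"
  define y where "y = (\<lambda>v. int (snd (prod_decode v)))"
  define z where "z = (\<lambda>v. int r - 1 - x v - y v)"
  have "card P = (\<Sum>i<r. r - i)"
    by (simp add: P_def)
  also have "\<dots> = \<Sum>{1..r}"
    by (rule sum.reindex_bij_witness[of _ "\<lambda>i. r - i" "\<lambda>i. r - i"]) auto
  also have "\<dots> = n"
    using gauss_sum_from_Suc_0[where n = r and 'a = nat] by (simp add: assms(2))
  finally have card_V: "card V = n"
    by (simp add: V_def card_image[OF inj_prod_encode])
  have fin: "finite V"
    by (simp add: V_def P_def)
  have bounds: "0 \<le> x v \<and> 0 \<le> y v \<and> 0 \<le> z v" if "v \<in> V" for v
    using that by (auto simp: V_def P_def x_def y_def z_def)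
  have sum: "x v + y v + z v = int r - 1" for v
    by (simp add: z_def)
  have inj: "u = v" if "x u = x v" "y u = y v" for u v
    using that by (metis x_def y_def of_nat_eq_iff prod_decode_inverse prod.collapse)
  define L where "L = [lex_order V x y, lex_order V y z, lex_order V z x]"
  define T where "T = majority_digraph V L"
  \<comment> \<open>Any two coordinates determine the third through the sum, and so the
    vertex.\<close>
  have lin: "linear_order_on V (lex_order V x y)" "linear_order_on V (lex_order V y z)"
      "linear_order_on V (lex_order V z x)"
    using inj by (auto intro!: linear_order_on_lex_order simp: z_def)
  have T: "majority_tournament 3 T"
    unfolding majority_tournament_def T_def
    using fin lin by (intro conjI exI[of _ V] exI[of _ L]) (auto simp: L_def)
  have pverts_T: "pverts T = V"
    by (simp add: T_def majority_digraph_def)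
  have card_le: "card S \<le> r" if S: "acyclic_set (with_proj T) S" for S
  proof -
    have "S \<subseteq> V"
      using S pverts_T by (simp add: acyclic_set_def)
    have "\<exists>s\<in>X. X - {s} \<subseteq> out_sectors x y z s" if X: "X \<subseteq> S" "X \<noteq> {}" for X
    proof -
      obtain s where s: "s \<in> X" "\<And>v. v \<in> X - {s} \<Longrightarrow> (s, v) \<in> parcs T"
        using acyclic_set_source[OF T S X] by blast
      have "v \<in> out_sectors x y z s" if "v \<in> X - {s}" for v
        using s(2)[OF that] inj sum unfolding T_def L_def
        by (rule majority_lex_order_out_sectors[rotated 2])
      with s(1) show ?thesis by blast
    qed
    \<comment> \<open>The whole of \<open>V\<close> is the triangle with lower bounds 0 and
      coordinate sum \<open>r - 1\<close>, so its side is \<open>r\<close>.\<close>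
    then have "int (card S) \<le> (int r - 1) + 1 - (0 + 0 + 0)"
      using fin \<open>S \<subseteq> V\<close> bounds sum finite_subset
      by (intro card_le_triangle_side[where x = x and y = y and z = z]) auto
    then show ?thesis by simp
  qed
  have "f_majority 3 n \<le> max_acyclic (with_proj T)"
    unfolding f_majority_def using T card_V pverts_T
    by (intro Min_le[OF f_majority_set_finite]) auto
  also have "\<dots> \<le> r"
    unfolding max_acyclic_def
  proof (rule Max.boundedI)
    show "finite {card S |S. acyclic_set (with_proj T) S}"
      using fin pverts_T by (intro max_acyclic_set_finite) simp
    show "{card S |S. acyclic_set (with_proj T) S} \<noteq> {}"
      using acyclic_set_empty by blast
  qed (use card_le in auto)
  finally have "f_majority 3 n \<le> r" .
  moreover have "let T = with_proj (majority_digraph V [lex_order V x y, lex_order V y z, lex_order V z x]) in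
      (\<forall>S \<subseteq> V. acyclic_set T S \<longleftrightarrow> transitive_set T S) \<and> (\<forall>S. acyclic_set T S \<longrightarrow> card S \<le> r)"
    using card_le acyclic_set_iff_transitive_set[OF T] by (simp add: T_def L_def Let_def)
  ultimately show ?thesis
    using fin card_V lin by blast
qed

end
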